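(* Let $\mathcal V_{W\dot WM_uM_y}$ be a generalized dynamical system and $\mathcal V_{W\dot W}$ a genaut. There exists a linear subspace $\mathcal V_{WM_u}$ of vectors on $W\uplus M_u$ such that $$(\mathcal V_{W\dot WM_uM_y}\cap\mathcal V_{WM_u})\circ W\dot W=\mathcal V_{W\dot W}\qquad( * )$$ if and only if $$\mathcal V_{W\dot WM_uM_y}\circ W\dot W\supseteq\mathcal V_{W\dot W}\quad\text{and}\quad \mathcal V_{W\dot WM_uM_y}\circ W\dot WM_u\times\dot W\subseteq\mathcal V_{W\dot W}\times\dot W .$$ Further, if such a $\mathcal V_{WM_u}$ exists, then the subspace $\mathcal V_{WM_u}$ satisfying $( * )$ is unique under the conditions $$\mathcal V_{W\dot WM_uM_y}\circ WM_u\supseteq\mathcal V_{WM_u}\quad\text{and}\quad \mathcal V_{W\dot WM_uM_y}\circ W\dot WM_u\times M_u\subseteq\mathcal V_{WM_u}\times M_u,$$ and it is then equal to $(\mathcal V_{W\dot WM_uM_y}\cap\mathcal V_{W\dot W})\circ WM_u$.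
   Context: Fix a field $\mathbb F$; all index sets are finite. A vector on $X$ is a function $X\to\mathbb F$. $W,\dot W$ are disjoint sets that are copies of each other (in bijection), and $M_u,M_y$ are further disjoint sets. A generalized dynamical system $\mathcal V_{W\dot WM_uM_y}$ is a linear subspace of vectors on $W\uplus\dot W\uplus M_u\uplus M_y$; a genaut $\mathcal V_{W\dot W}$ is a linear subspace of vectors on $W\uplus\dot W$. For $T\subseteq S$: $\mathcal V_S\circ T$ is the set of restrictions to $T$ of vectors in $\mathcal V_S$; $\mathcal V_S\times T:=\{f_T:(f_T,0_{S\setminus T})\in\mathcal V_S\}$. Such operations are applied left to right, and juxtaposition such as $W\dot WM_u$ means the disjoint union. For spaces on different index sets, $\mathcal V_X\cap\mathcal V_Y$ is the set of vectors on $X\cup Y$ whose restriction to $X$ is in $\mathcal V_X$ and whose restriction to $Y$ is in $\mathcal V_Y$. *)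

theory Defs
  imports Main "HOL-Library.FuncSet"
begin

text \<open>
  A vector on \<open>X\<close> is an element of \<open>extensional X\<close>, the usual representation of the functions
  with domain exactly \<open>X\<close>. The type-based notion of subspace of the library does not apply to these
  (sums of values outside \<open>X\<close> need not be \<open>undefined\<close>), so the operations are taken on \<open>X\<close>.
\<close>

definition subspace_on :: "'i set \<Rightarrow> ('i \<Rightarrow> 'f::field) set \<Rightarrow> bool" where
  "subspace_on X V \<longleftrightarrow>
     V \<subseteq> extensional X \<and>
     (\<lambda>i\<in>X. 0) \<in> V \<and>
     (\<forall>f\<in>V. \<forall>g\<in>V. (\<lambda>i\<in>X. f i + g i) \<in> V) \<and>
     (\<forall>a. \<forall>f\<in>V. (\<lambda>i\<in>X. a * f i) \<in> V)"

definition generalized_dynamical_system ::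
  "'i set \<Rightarrow> 'i set \<Rightarrow> 'i set \<Rightarrow> 'i set \<Rightarrow> ('i \<Rightarrow> 'f::field) set \<Rightarrow> bool" where
  "generalized_dynamical_system W Wd Mu My V \<longleftrightarrow> subspace_on (W \<union> Wd \<union> Mu \<union> My) V"

definition genaut :: "'i set \<Rightarrow> 'i set \<Rightarrow> ('i \<Rightarrow> 'f::field) set \<Rightarrow> bool" where
  "genaut W Wd V \<longleftrightarrow> subspace_on (W \<union> Wd) V"

definition restriction :: "('i \<Rightarrow> 'f) set \<Rightarrow> 'i set \<Rightarrow> ('i \<Rightarrow> 'f) set" where
  "restriction V T = (\<lambda>f. restrict f T) ` V"

text \<open>
  \<open>contraction S V T\<close> is \<open>V \<times> T\<close> for a space \<open>V\<close> of vectors on \<open>S \<supseteq> T\<close>; the index set \<open>S\<close>, which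
  cannot be read off an arbitrary set of functions, is passed explicitly. The same holds for \<open>X\<close>
  and \<open>Y\<close> in \<open>intersection X V Y U\<close>.
\<close>

definition contraction :: "'i set \<Rightarrow> ('i \<Rightarrow> 'f::zero) set \<Rightarrow> 'i set \<Rightarrow> ('i \<Rightarrow> 'f) set" where
  "contraction S V T = {f \<in> extensional T. (\<lambda>i\<in>S. if i \<in> T then f i else 0) \<in> V}"

definition intersection ::
  "'i set \<Rightarrow> ('i \<Rightarrow> 'f) set \<Rightarrow> 'i set \<Rightarrow> ('i \<Rightarrow> 'f) set \<Rightarrow> ('i \<Rightarrow> 'f) set" where
  "intersection X V Y U = {f \<in> extensional (X \<union> Y). restrict f X \<in> V \<and> restrict f Y \<in> U}"

end

theory Submission
  imports Defs
begin

text \<open>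
  The two halves of the theorem are one exchange principle, used with the roles of \<open>Wd\<close> and \<open>Mu\<close>
  swapped. For pairwise disjoint \<open>A\<close>, \<open>B\<close>, \<open>C\<close>, view \<open>V\<close> as a relation between vectors on
  \<open>A \<union> B\<close> and vectors on \<open>A \<union> C\<close> that agree on \<open>A\<close>. A space \<open>U\<close> on \<open>A \<union> C\<close> then has an image \<open>D\<close>
  on \<open>A \<union> B\<close>, and the question is which \<open>D\<close> are images and how far \<open>U\<close> can be recovered.

  \<^item> An image \<open>D\<close> lies in the range \<open>V \<circ> (A \<union> B)\<close>. It also contains the part of \<open>V\<close> that the
    \<open>A \<union> C\<close> coordinates cannot see: if \<open>h \<in> V\<close> vanishes on \<open>A \<union> C\<close>, it restricts there to the zero
    vector of \<open>U\<close>, so the restriction of \<open>h\<close> to \<open>A \<union> B\<close> is in \<open>D\<close> (\<open>image_range_and_kernel\<close>).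
  \<^item> For any \<open>D\<close> with these two properties, pulling \<open>D\<close> back to \<open>A \<union> C\<close> and mapping the result
    forward returns \<open>D\<close> (\<open>exchange_round_trip\<close>): every member of \<open>D\<close> is reached because \<open>D\<close> lies in
    the range, and two elements of \<open>V\<close> with the same restriction to \<open>A \<union> C\<close> differ by an invisible
    one, so nothing new is reached.

  With \<open>B = Wd\<close> and \<open>C = Mu\<close> this gives the criterion, with the pullback of \<open>D\<close> as solution. With
  \<open>B = Mu\<close> and \<open>C = Wd\<close> the first item says that this pullback satisfies the two side conditions, and
  the second says that a solution \<open>U\<close> satisfying them is the pullback of its image, which is \<open>D\<close>.
\<close>

lemma subspace_on_diff:
  assumes "subspace_on X V" "f \<in> V" "g \<in> V"
  shows "(\<lambda>i\<in>X. f i - g i) \<in> V"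
proof -
  have "(\<lambda>i\<in>X. (-1) * g i) \<in> V"
    using assms unfolding subspace_on_def by blast
  then have "(\<lambda>i\<in>X. f i + (\<lambda>i\<in>X. (-1) * g i) i) \<in> V"
    using assms(1,2) unfolding subspace_on_def by blast
  moreover have "(\<lambda>i\<in>X. f i + (\<lambda>i\<in>X. (-1) * g i) i) = (\<lambda>i\<in>X. f i - g i)"
    by (rule ext) simp
  ultimately show ?thesis by simp
qed

lemma mem_restriction_intersection_iff:
  assumes "V \<subseteq> extensional X" "Y \<subseteq> X"
  shows "g \<in> restriction (intersection X V Y U) Z \<longleftrightarrow>
    (\<exists>f\<in>V. restrict f Y \<in> U \<and> g = restrict f Z)"
proof -
  have "X \<union> Y = X" using assms(2) by blast
  moreover have "restrict f X = f" if "f \<in> extensional X" for f :: "'a \<Rightarrow> 'b"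
    using that by (rule extensional_restrict)
  ultimately have "intersection X V Y U = {f \<in> V. restrict f Y \<in> U}"
    using assms(1) unfolding intersection_def by auto
  then show ?thesis
    unfolding restriction_def by blast
qed

lemma subspace_on_restriction_intersection:
  fixes V U :: "('i \<Rightarrow> 'f::field) set"
  assumes V: "subspace_on X V" and U: "subspace_on Y U" and "Y \<subseteq> X" "Z \<subseteq> X"
  shows "subspace_on Z (restriction (intersection X V Y U) Z)"
proof -
  have ext: "V \<subseteq> extensional X"
    using V unfolding subspace_on_def by blast
  note mem = mem_restriction_intersection_iff[OF ext \<open>Y \<subseteq> X\<close>, of _ U Z]
  have 1: "(\<lambda>i\<in>Z. 0) \<in> restriction (intersection X V Y U) Z"
  proof -
    have "(\<lambda>i\<in>X. 0::'f) \<in> V" "(\<lambda>i\<in>Y. 0::'f) \<in> U"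
      using V U unfolding subspace_on_def by blast+
    moreover have "restrict (\<lambda>i\<in>X. 0::'f) Y = (\<lambda>i\<in>Y. 0)" "restrict (\<lambda>i\<in>X. 0::'f) Z = (\<lambda>i\<in>Z. 0)"
      using assms(3,4) by (auto simp: fun_eq_iff)
    ultimately show ?thesis unfolding mem by metis
  qed
  have 2: "(\<lambda>i\<in>Z. f i + g i) \<in> restriction (intersection X V Y U) Z"
    if f: "f \<in> restriction (intersection X V Y U) Z"
      and g: "g \<in> restriction (intersection X V Y U) Z" for f g
  proof -
    obtain f' where f': "f' \<in> V" "restrict f' Y \<in> U" "f = restrict f' Z"
      using f unfolding mem by blast
    obtain g' where g': "g' \<in> V" "restrict g' Y \<in> U" "g = restrict g' Z"
      using g unfolding mem by blast
    have "(\<lambda>i\<in>X. f' i + g' i) \<in> V" "(\<lambda>i\<in>Y. restrict f' Y i + restrict g' Y i) \<in> U"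
      using V U f' g' unfolding subspace_on_def by blast+
    moreover have "restrict (\<lambda>i\<in>X. f' i + g' i) Y = (\<lambda>i\<in>Y. restrict f' Y i + restrict g' Y i)"
      "restrict (\<lambda>i\<in>X. f' i + g' i) Z = (\<lambda>i\<in>Z. f i + g i)"
      using assms(3,4) f'(3) g'(3) by (auto simp: fun_eq_iff)
    ultimately show ?thesis unfolding mem by metis
  qed
  have 3: "(\<lambda>i\<in>Z. a * f i) \<in> restriction (intersection X V Y U) Z"
    if f: "f \<in> restriction (intersection X V Y U) Z" for a f
  proof -
    obtain f' where f': "f' \<in> V" "restrict f' Y \<in> U" "f = restrict f' Z"
      using f unfolding mem by blast
    have "(\<lambda>i\<in>X. a * f' i) \<in> V" "(\<lambda>i\<in>Y. a * restrict f' Y i) \<in> U"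
      using V U f' unfolding subspace_on_def by blast+
    moreover have "restrict (\<lambda>i\<in>X. a * f' i) Y = (\<lambda>i\<in>Y. a * restrict f' Y i)"
      "restrict (\<lambda>i\<in>X. a * f' i) Z = (\<lambda>i\<in>Z. a * f i)"
      using assms(3,4) f'(3) by (auto simp: fun_eq_iff)
    ultimately show ?thesis unfolding mem by metis
  qed
  have "restriction (intersection X V Y U) Z \<subseteq> extensional Z"
    unfolding restriction_def by auto
  then show ?thesis
    unfolding subspace_on_def using 1 2 3 by blast
qed

text \<open>
  In this form the contraction condition speaks about elements of \<open>V\<close> alone, so it can be applied
  directly to a difference of two elements. The union of the three index sets is a separate
  variable \<open>T\<close>, so that the lemma also applies with \<open>B\<close> and \<open>C\<close> exchanged.
\<close>

lemma contraction_subset_iff: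
  fixes V D :: "('i \<Rightarrow> 'f::zero) set"
  assumes T: "T = A \<union> B \<union> C" and "A \<inter> B = {}" "B \<inter> C = {}"
  shows "contraction T (restriction V T) B \<subseteq> contraction (A \<union> B) D B \<longleftrightarrow>
    (\<forall>h\<in>V. (\<forall>i\<in>A \<union> C. h i = 0) \<longrightarrow> restrict h (A \<union> B) \<in> D)"
proof
  assume sub: "contraction T (restriction V T) B \<subseteq> contraction (A \<union> B) D B"
  show "\<forall>h\<in>V. (\<forall>i\<in>A \<union> C. h i = 0) \<longrightarrow> restrict h (A \<union> B) \<in> D"
  proof (intro ballI impI)
    fix h assume h: "h \<in> V" "\<forall>i\<in>A \<union> C. h i = 0"
    have "(\<lambda>i\<in>T. if i \<in> B then restrict h B i else 0) = restrict h T"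
      using h(2) T by (auto simp: fun_eq_iff)
    then have "restrict h B \<in> contraction T (restriction V T) B"
      using h(1) unfolding contraction_def restriction_def by simp
    then have "restrict h B \<in> contraction (A \<union> B) D B"
      using sub by blast
    then have "(\<lambda>i\<in>A \<union> B. if i \<in> B then restrict h B i else 0) \<in> D"
      unfolding contraction_def by simp
    moreover have "(\<lambda>i\<in>A \<union> B. if i \<in> B then restrict h B i else 0) = restrict h (A \<union> B)"
      using h(2) by (auto simp: fun_eq_iff)
    ultimately show "restrict h (A \<union> B) \<in> D" by simp
  qed
next
  assume ker: "\<forall>h\<in>V. (\<forall>i\<in>A \<union> C. h i = 0) \<longrightarrow> restrict h (A \<union> B) \<in> D"
  show "contraction T (restriction V T) B \<subseteq> contraction (A \<union> B) D B"
  proof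
    fix f assume "f \<in> contraction T (restriction V T) B"
    then obtain h where f: "f \<in> extensional B" and h: "h \<in> V"
      and eq: "(\<lambda>i\<in>T. if i \<in> B then f i else 0) = restrict h T"
      unfolding contraction_def restriction_def by auto
    have val: "h i = (if i \<in> B then f i else 0)" if "i \<in> T" for i
      using fun_cong[OF eq, of i] that by simp
    have "\<forall>i\<in>A \<union> C. h i = 0"
      using val assms by auto
    then have "restrict h (A \<union> B) \<in> D"
      using ker h by blast
    moreover have "restrict h (A \<union> B) = (\<lambda>i\<in>A \<union> B. if i \<in> B then f i else 0)"
      using val T by (auto simp: fun_eq_iff)
    ultimately show "f \<in> contraction (A \<union> B) D B"
      using f unfolding contraction_def by simp
  qed
qed

text \<open>
  Necessity: an element of \<open>V\<close> vanishing on \<open>A \<union> C\<close> restricts there to the zero vector, so it is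
  admitted by \<open>U\<close> as soon as \<open>U\<close> contains zero, and therefore lies over the image \<open>D\<close>.
\<close>

lemma image_range_and_kernel:
  fixes V U :: "('i \<Rightarrow> 'f::field) set"
  assumes V: "subspace_on S V" and "(\<lambda>i\<in>A \<union> C. 0) \<in> U"
    and T: "T = A \<union> B \<union> C" "T \<subseteq> S" and "A \<inter> B = {}" "B \<inter> C = {}"
    and D: "restriction (intersection S V (A \<union> C) U) (A \<union> B) = D"
  shows "D \<subseteq> restriction V (A \<union> B)"
    and "contraction T (restriction V T) B \<subseteq> contraction (A \<union> B) D B"
proof -
  have "V \<subseteq> extensional S" "A \<union> C \<subseteq> S"
    using V T unfolding subspace_on_def by auto
  note mem = mem_restriction_intersection_iff[OF this, of _ U "A \<union> B", unfolded D]
  show "D \<subseteq> restriction V (A \<union> B)"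
    unfolding restriction_def using mem by blast
  have "restrict h (A \<union> B) \<in> D" if "h \<in> V" "\<forall>i\<in>A \<union> C. h i = 0" for h
  proof -
    have "restrict h (A \<union> C) = (\<lambda>i\<in>A \<union> C. 0)"
      using that(2) by (intro restrict_ext) blast
    then show ?thesis
      unfolding mem using that(1) assms(2) by metis
  qed
  then show "contraction T (restriction V T) B \<subseteq> contraction (A \<union> B) D B"
    using contraction_subset_iff[OF T(1) assms(5,6)] by blast
qed

text \<open>
  Sufficiency: an element \<open>f\<close> of \<open>V\<close> that takes part in the round trip agrees on \<open>A \<union> C\<close> with some
  \<open>f'\<close> of \<open>V\<close> lying over \<open>D\<close>. The difference \<open>f - f'\<close> vanishes on \<open>A \<union> C\<close>, so the contraction
  condition puts it over \<open>D\<close>, hence \<open>f\<close> lies over \<open>D\<close> as well.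
\<close>

lemma exchange_round_trip:
  fixes V D :: "('i \<Rightarrow> 'f::field) set"
  assumes V: "subspace_on S V" and D: "subspace_on (A \<union> B) D"
    and T: "T = A \<union> B \<union> C" "T \<subseteq> S" and "A \<inter> B = {}" "B \<inter> C = {}"
    and range: "D \<subseteq> restriction V (A \<union> B)"
    and ker: "contraction T (restriction V T) B \<subseteq> contraction (A \<union> B) D B"
  shows "restriction (intersection S V (A \<union> C)
    (restriction (intersection S V (A \<union> B) D) (A \<union> C))) (A \<union> B) = D"
proof -
  have V_ext: "V \<subseteq> extensional S" and AC: "A \<union> C \<subseteq> S" and AB: "A \<union> B \<subseteq> S"
    using V T unfolding subspace_on_def by auto
  note mem = mem_restriction_intersection_iff[OF V_ext AC]
    mem_restriction_intersection_iff[OF V_ext AB]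
  have over_D: "restrict f (A \<union> B) \<in> D"
    if f: "f \<in> V" and f': "f' \<in> V" "restrict f' (A \<union> B) \<in> D"
      and agree: "restrict f (A \<union> C) = restrict f' (A \<union> C)" for f f'
  proof -
    define h where "h = (\<lambda>i\<in>S. f i - f' i)"
    have "h \<in> V"
      unfolding h_def using V f f'(1) by (rule subspace_on_diff)
    moreover have "\<forall>i\<in>A \<union> C. h i = 0"
    proof
      fix i assume i: "i \<in> A \<union> C"
      then have "f i = f' i" using fun_cong[OF agree, of i] by simp
      then show "h i = 0" using i AC unfolding h_def by auto
    qed
    ultimately have "restrict h (A \<union> B) \<in> D"
      using ker contraction_subset_iff[OF T(1) assms(5,6), of V D] by blast
    then have "(\<lambda>i\<in>A \<union> B. restrict h (A \<union> B) i + restrict f' (A \<union> B) i) \<in> D"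
      using D f'(2) unfolding subspace_on_def by blast
    moreover have "(\<lambda>i\<in>A \<union> B. restrict h (A \<union> B) i + restrict f' (A \<union> B) i) = restrict f (A \<union> B)"
      using AB unfolding h_def by (auto simp: fun_eq_iff)
    ultimately show ?thesis by simp
  qed
  show ?thesis
  proof (intro set_eqI iffI)
    fix g assume "g \<in> D"
    then obtain f where "f \<in> V" "g = restrict f (A \<union> B)"
      using range unfolding restriction_def by blast
    then show "g \<in> restriction (intersection S V (A \<union> C)
      (restriction (intersection S V (A \<union> B) D) (A \<union> C))) (A \<union> B)"
      using \<open>g \<in> D\<close> unfolding mem by blast
  next
    fix g assume "g \<in> restriction (intersection S V (A \<union> C)
      (restriction (intersection S V (A \<union> B) D) (A \<union> C))) (A \<union> B)"
    then show "g \<in> D"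
      unfolding mem using over_D by blast
  qed
qed

theorem theorem37:
  fixes W Wd Mu My :: "'i set"
    and c :: "'i \<Rightarrow> 'i"
    and V D :: "('i \<Rightarrow> 'f::field) set"
  assumes "finite W" and "finite Wd" and "finite Mu" and "finite My"
    and "W \<inter> Wd = {}" and "W \<inter> Mu = {}" and "W \<inter> My = {}"
    and "Wd \<inter> Mu = {}" and "Wd \<inter> My = {}" and "Mu \<inter> My = {}"
    and "bij_betw c W Wd"
    and "generalized_dynamical_system W Wd Mu My V"
    and "genaut W Wd D"
  shows
    "((\<exists>U. subspace_on (W \<union> Mu) U \<and>
          restriction (intersection (W \<union> Wd \<union> Mu \<union> My) V (W \<union> Mu) U) (W \<union> Wd) = D)
      \<longleftrightarrow>
      (restriction V (W \<union> Wd) \<supseteq> D \<and>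
       contraction (W \<union> Wd \<union> Mu) (restriction V (W \<union> Wd \<union> Mu)) Wd \<subseteq> contraction (W \<union> Wd) D Wd))
     \<and>
     ((\<exists>U. subspace_on (W \<union> Mu) U \<and>
          restriction (intersection (W \<union> Wd \<union> Mu \<union> My) V (W \<union> Mu) U) (W \<union> Wd) = D)
      \<longrightarrow>
      (\<exists>!U. subspace_on (W \<union> Mu) U \<and>
          restriction (intersection (W \<union> Wd \<union> Mu \<union> My) V (W \<union> Mu) U) (W \<union> Wd) = D \<and>
          restriction V (W \<union> Mu) \<supseteq> U \<and>
          contraction (W \<union> Wd \<union> Mu) (restriction V (W \<union> Wd \<union> Mu)) Mu \<subseteq> contraction (W \<union> Mu) U Mu)
      \<and>
      (\<forall>U. subspace_on (W \<union> Mu) U \<and>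
          restriction (intersection (W \<union> Wd \<union> Mu \<union> My) V (W \<union> Mu) U) (W \<union> Wd) = D \<and>
          restriction V (W \<union> Mu) \<supseteq> U \<and>
          contraction (W \<union> Wd \<union> Mu) (restriction V (W \<union> Wd \<union> Mu)) Mu \<subseteq> contraction (W \<union> Mu) U Mu
        \<longrightarrow> U = restriction (intersection (W \<union> Wd \<union> Mu \<union> My) V (W \<union> Wd) D) (W \<union> Mu)))"
proof -
  let ?S = "W \<union> Wd \<union> Mu \<union> My" and ?T = "W \<union> Wd \<union> Mu"
  let ?implements = "\<lambda>U. subspace_on (W \<union> Mu) U \<and>
    restriction (intersection ?S V (W \<union> Mu) U) (W \<union> Wd) = D"
  let ?criterion = "D \<subseteq> restriction V (W \<union> Wd) \<and>
    contraction ?T (restriction V ?T) Wd \<subseteq> contraction (W \<union> Wd) D Wd"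
  let ?normalized = "\<lambda>U. U \<subseteq> restriction V (W \<union> Mu) \<and>
    contraction ?T (restriction V ?T) Mu \<subseteq> contraction (W \<union> Mu) U Mu"
  let ?K = "restriction (intersection ?S V (W \<union> Wd) D) (W \<union> Mu)"
  have V: "subspace_on ?S V" and D: "subspace_on (W \<union> Wd) D"
    using assms unfolding generalized_dynamical_system_def genaut_def by simp_all
  have T: "?T \<subseteq> ?S" and T_swap: "?T = W \<union> Mu \<union> Wd"
    by auto
  have disj: "W \<inter> Wd = {}" "Wd \<inter> Mu = {}" "W \<inter> Mu = {}" "Mu \<inter> Wd = {}"
    using assms by auto
  have zero: "(\<lambda>i\<in>X. 0) \<in> U" if "subspace_on X U" for X and U :: "('i \<Rightarrow> 'f) set"
    using that unfolding subspace_on_def by blast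
  have K: "subspace_on (W \<union> Mu) ?K"
    using V D by (rule subspace_on_restriction_intersection) auto
  have necessary: ?criterion if "?implements U" for U
    using image_range_and_kernel[OF V _ refl T disj(1,2), of U D] that zero by blast
  have sufficient: "?implements ?K" if ?criterion
    using exchange_round_trip[OF V D refl T disj(1,2)] that K by blast
  have K_normalized: "?normalized ?K"
    using image_range_and_kernel[OF V zero[OF D] T_swap T disj(3,4) refl] by blast
  have unique: "U = ?K" if "?implements U" "?normalized U" for U
  proof -
    have "restriction (intersection ?S V (W \<union> Wd)
        (restriction (intersection ?S V (W \<union> Mu) U) (W \<union> Wd))) (W \<union> Mu) = U"
      using that by (intro exchange_round_trip[OF V _ T_swap T disj(3,4)]) blast+
    then show ?thesis
      using that(1) by simp
  qed
  show ?thesis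
  proof (intro conjI impI allI)
    show "(\<exists>U. ?implements U) \<longleftrightarrow> ?criterion"
      using necessary sufficient by metis
  next
    assume "\<exists>U. ?implements U"
    then have "?implements ?K"
      using necessary sufficient by metis
    show "\<exists>!U. subspace_on (W \<union> Mu) U \<and>
        restriction (intersection ?S V (W \<union> Mu) U) (W \<union> Wd) = D \<and> ?normalized U"
    proof (rule ex1I[of _ ?K])
      show "subspace_on (W \<union> Mu) ?K \<and>
          restriction (intersection ?S V (W \<union> Mu) ?K) (W \<union> Wd) = D \<and> ?normalized ?K"
        using \<open>?implements ?K\<close> K_normalized by (elim conjE) (intro conjI)
    next
      fix U
      assume "subspace_on (W \<union> Mu) U \<and>
          restriction (intersection ?S V (W \<union> Mu) U) (W \<union> Wd) = D \<and> ?normalized U"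
      then show "U = ?K"
        by (elim conjE) (intro unique conjI)
    qed
  next
    fix U
    assume "subspace_on (W \<union> Mu) U \<and>
        restriction (intersection ?S V (W \<union> Mu) U) (W \<union> Wd) = D \<and> ?normalized U"
    then show "U = ?K"
      by (elim conjE) (intro unique conjI)
  qed
qed

end
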